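(* Let $k\ge1$. Let $T_k(x)=\sum_{n\ge1}t_{n,k}x^n$, where $t_{n,k}$ is the total number, over all Schroeder trees with $n$ leaves, of vertices having a subtree of size $k$. Let $R_k(x)=\sum_{n\ge1}r_{n,k}x^n$, where $r_{n,k}$ is the number of Schroeder trees with $n$ leaves and exactly $k$ vertices in total. Then $$T_k(x)=R_k(x)\,\frac{3-x+\sqrt{1-6x+x^2}}{4\sqrt{1-6x+x^2}}.$$
   Context: A Schroeder tree is a finite rooted plane tree (the children of each vertex are linearly ordered) in which every non-leaf vertex has at least two children. A leaf is a vertex with no children; the one-vertex tree is a Schroeder tree with one leaf. Trees are counted up to isomorphism of rooted plane trees. A vertex $v$ has a subtree of size $k$ if the subtree consisting of $v$ and all its descendants has exactly $k$ vertices. $\sqrt{1-6x+x^2}$ denotes the formal power series square root with constant term $1$. *)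

theory Defs
  imports "HOL-Computational_Algebra.Formal_Power_Series"
begin

text \<open>
  Finite rooted plane trees: a vertex is given by the ordered list of the subtrees hanging off it.
  Distinct values are non-isomorphic, so counting values is counting up to isomorphism.
\<close>

datatype plane_tree = Node (children: "plane_tree list")

text \<open>
  A vertex is addressed by the path from the root to it, as the list of child indices
  (counted from 0) taken on the way; the root is the empty list.
\<close>

primrec is_vertex :: "nat list \<Rightarrow> plane_tree \<Rightarrow> bool" where
  "is_vertex [] t \<longleftrightarrow> True"
| "is_vertex (i # v) t \<longleftrightarrow> i < length (children t) \<and> is_vertex v (children t ! i)"

definition vertices :: "plane_tree \<Rightarrow> nat list set" where
  "vertices t = {v. is_vertex v t}"

text \<open>The subtree consisting of a vertex and all its descendants (meaningful for actual vertices only).\<close>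

primrec subtree_at :: "nat list \<Rightarrow> plane_tree \<Rightarrow> plane_tree" where
  "subtree_at [] t = t"
| "subtree_at (i # v) t = subtree_at v (children t ! i)"

definition num_vertices :: "plane_tree \<Rightarrow> nat" where
  "num_vertices t = card (vertices t)"

definition num_children :: "plane_tree \<Rightarrow> nat list \<Rightarrow> nat" where
  "num_children t v = length (children (subtree_at v t))"

definition leaves :: "plane_tree \<Rightarrow> nat list set" where
  "leaves t = {v \<in> vertices t. num_children t v = 0}"

definition schroeder_tree :: "plane_tree \<Rightarrow> bool" where
  "schroeder_tree t \<longleftrightarrow> (\<forall>v \<in> vertices t. v \<notin> leaves t \<longrightarrow> num_children t v \<ge> 2)"

definition schroeder_trees :: "nat \<Rightarrow> plane_tree set" where
  "schroeder_trees n = {t. schroeder_tree t \<and> card (leaves t) = n}"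

definition t_count :: "nat \<Rightarrow> nat \<Rightarrow> nat" where
  "t_count n k =
     (\<Sum>t \<in> schroeder_trees n. card {v \<in> vertices t. num_vertices (subtree_at v t) = k})"

definition r_count :: "nat \<Rightarrow> nat \<Rightarrow> nat" where
  "r_count n k = card {t \<in> schroeder_trees n. num_vertices t = k}"

definition T_series :: "nat \<Rightarrow> real fps" where
  "T_series k = Abs_fps (\<lambda>n. if n \<ge> 1 then real (t_count n k) else 0)"

definition R_series :: "nat \<Rightarrow> real fps" where
  "R_series k = Abs_fps (\<lambda>n. if n \<ge> 1 then real (r_count n k) else 0)"

text \<open>
  The argument \<^term>\<open>root\<close> selects the constant term of the square root, here \<open>root 2 1 = 1\<close>.
\<close>

definition sqrt_series :: "real fps" where
  "sqrt_series = fps_radical root 2 (1 - 6 * fps_X + fps_X ^ 2)"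

lemma sqrt_series_nth_0: "fps_nth sqrt_series 0 = 1"
  by (simp add: sqrt_series_def)

lemma sqrt_series_squared: "sqrt_series ^ 2 = 1 - 6 * fps_X + fps_X ^ 2"
proof -
  have "fps_radical root (Suc 1) (1 - 6 * fps_X + fps_X ^ 2 :: real fps) ^ Suc 1
          = 1 - 6 * fps_X + fps_X ^ 2"
    by (subst power_radical[symmetric]) simp_all
  then show ?thesis
    by (simp add: sqrt_series_def numeral_2_eq_2)
qed

end

theory Submission
  imports Defs
begin

text \<open>
  Let \<open>S\<close>, \<open>F\<close> be the generating functions by leaves of Schroeder trees and of finite lists of
  Schroeder trees. Splitting off the head of a list gives \<open>F = 1 + S F\<close>, and cutting off the root
  gives \<open>S = x + (F - 1 - S)\<close>; hence \<open>(1 + x - 4 S)\<^sup>2 = 1 - 6 x + x\<^sup>2\<close>. Marking a vertex whose subtree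
  has size \<open>k\<close>, the same decompositions give \<open>M = T\<^sub>k F + S M\<close> for lists with one marked vertex
  and \<open>T\<^sub>k = R\<^sub>k + (M - T\<^sub>k)\<close>. So \<open>T\<^sub>k (2 - F\<^sup>2) = R\<^sub>k\<close>, and with the square root \<open>s\<close> one has
  \<open>1 - S = (3 - x + s) / 4\<close> and \<open>(1 - S) (2 - F\<^sup>2) = s\<close>.
\<close>

section \<open>Weighted generating functions\<close>

text \<open>The weight serves two purposes: constantly 1 it counts objects, and as the number of
  admissible vertices in an object it counts objects with one marked vertex.\<close>

definition gf :: "'a set \<Rightarrow> ('a \<Rightarrow> nat) \<Rightarrow> ('a \<Rightarrow> real) \<Rightarrow> real fps" where
  "gf A s w = Abs_fps (\<lambda>n. \<Sum>a \<in> {a \<in> A. s a = n}. w a)"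

text \<open>A sum over an infinite set is 0 by convention, so the union and product laws for
  \<open>gf\<close> are stated for sets with finite levels.\<close>

definition finite_levels :: "'a set \<Rightarrow> ('a \<Rightarrow> nat) \<Rightarrow> bool" where
  "finite_levels A s \<longleftrightarrow> (\<forall>n. finite {a \<in> A. s a = n})"

lemma finite_levels_subset:
  assumes "finite_levels B s" "A \<subseteq> B"
  shows "finite_levels A s"
  unfolding finite_levels_def
proof
  fix n
  have "{a \<in> A. s a = n} \<subseteq> {a \<in> B. s a = n}" using assms(2) by blast
  moreover have "finite {a \<in> B. s a = n}" using assms(1) by (simp add: finite_levels_def)
  ultimately show "finite {a \<in> A. s a = n}" by (rule finite_subset)
qed

lemma gf_add: "gf A s (\<lambda>a. v a + w a) = gf A s v + gf A s w"
  by (simp add: gf_def fps_eq_iff sum.distrib)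

lemma gf_cong:
  assumes "\<And>a. a \<in> A \<Longrightarrow> s a = s' a" "\<And>a. a \<in> A \<Longrightarrow> v a = w a"
  shows "gf A s v = gf A s' w"
proof (rule fps_ext)
  fix n
  have "{a \<in> A. s a = n} = {a \<in> A. s' a = n}" using assms(1) by auto
  then show "fps_nth (gf A s v) n = fps_nth (gf A s' w) n"
    by (simp add: gf_def assms(2))
qed

lemma gf_union:
  assumes "finite_levels (A \<union> B) s" "A \<inter> B = {}"
  shows "gf (A \<union> B) s w = gf A s w + gf B s w"
proof (rule fps_ext)
  fix n
  have "finite {a \<in> A. s a = n}" "finite {a \<in> B. s a = n}"
    using finite_levels_subset[OF assms(1) Un_upper1] finite_levels_subset[OF assms(1) Un_upper2]
    by (simp_all add: finite_levels_def)
  moreover have "{a \<in> A \<union> B. s a = n} = {a \<in> A. s a = n} \<union> {a \<in> B. s a = n}" by blast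
  ultimately show "fps_nth (gf (A \<union> B) s w) n = fps_nth (gf A s w + gf B s w) n"
    using assms(2) by (auto simp: gf_def intro!: sum.union_disjoint)
qed

lemma gf_image:
  assumes "inj_on h A"
  shows "gf (h ` A) s w = gf A (\<lambda>a. s (h a)) (\<lambda>a. w (h a))"
proof (rule fps_ext)
  fix n
  have "{b \<in> h ` A. s b = n} = h ` {a \<in> A. s (h a) = n}" by blast
  moreover have "inj_on h {a \<in> A. s (h a) = n}" using assms by (rule inj_on_subset) blast
  ultimately show "fps_nth (gf (h ` A) s w) n = fps_nth (gf A (\<lambda>a. s (h a)) (\<lambda>a. w (h a))) n"
    by (simp add: gf_def sum.reindex)
qed

lemma gf_singleton: "gf {a} s w = fps_const (w a) * fps_X ^ s a"
proof (rule fps_ext)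
  fix n
  have "{b \<in> {a}. s b = n} = (if n = s a then {a} else {})" by auto
  then show "fps_nth (gf {a} s w) n = fps_nth (fps_const (w a) * fps_X ^ s a) n"
    by (simp add: gf_def)
qed

text \<open>Level \<open>n\<close> of the product is the disjoint union over \<open>i\<close> of
  level \<open>i\<close> of \<open>A\<close> times level \<open>n - i\<close> of \<open>B\<close>,
  which is the Cauchy product.\<close>

lemma gf_times:
  assumes "finite_levels A s" "finite_levels B r"
  shows "gf (A \<times> B) (\<lambda>(a, b). s a + r b) (\<lambda>(a, b). v a * w b) = gf A s v * gf B r w"
proof (rule fps_ext)
  fix n
  let ?C = "\<lambda>i. {a \<in> A. s a = i} \<times> {b \<in> B. r b = n - i}"
  have eq: "{p \<in> A \<times> B. (case p of (a, b) \<Rightarrow> s a + r b) = n} = (\<Union>i \<in> {0..n}. ?C i)"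
    by auto
  have "(\<Sum>p \<in> (\<Union>i \<in> {0..n}. ?C i). case p of (a, b) \<Rightarrow> v a * w b)
      = (\<Sum>i = 0..n. \<Sum>p \<in> ?C i. case p of (a, b) \<Rightarrow> v a * w b)"
    using assms by (intro sum.UNION_disjoint) (auto simp: finite_levels_def)
  also have "\<dots> = (\<Sum>i = 0..n. (\<Sum>a \<in> {a \<in> A. s a = i}. v a) * (\<Sum>b \<in> {b \<in> B. r b = n - i}. w b))"
    by (simp add: sum_product sum.cartesian_product)
  finally show "fps_nth (gf (A \<times> B) (\<lambda>(a, b). s a + r b) (\<lambda>(a, b). v a * w b)) n
      = fps_nth (gf A s v * gf B r w) n"
    unfolding gf_def fps_nth_Abs_fps eq fps_mult_nth .
qed

section \<open>Recursion over plane trees\<close>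

text \<open>With \<open>children t = []\<close> as predicate this counts leaves; with
  \<open>num_vertices t = k\<close> it is the summand of \<open>t_count\<close>. One recursion then
  covers both.\<close>

definition occurrences :: "(plane_tree \<Rightarrow> bool) \<Rightarrow> plane_tree \<Rightarrow> nat" where
  "occurrences P t = card {v \<in> vertices t. P (subtree_at v t)}"

lemma vertices_Node:
  "vertices (Node ts) = insert [] (\<Union>i < length ts. (#) i ` vertices (ts ! i))"
proof (rule set_eqI)
  fix v show "v \<in> vertices (Node ts) \<longleftrightarrow> v \<in> insert [] (\<Union>i < length ts. (#) i ` vertices (ts ! i))"
    by (cases v) (auto simp: vertices_def)
qed

lemma finite_vertices: "finite (vertices t)"
  by (induction t) (auto simp: vertices_Node)

text \<open>The vertices below the root fall into disjoint classes by the first index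
  \<open>i\<close> of their path, and class \<open>i\<close> is a copy of the \<open>i\<close>-th
  child with the same subtrees.\<close>

lemma occurrences_Node:
  "occurrences P (Node ts) = of_bool (P (Node ts)) + (\<Sum>t\<leftarrow>ts. occurrences P t)"
proof -
  let ?V = "\<lambda>i. {v \<in> vertices (ts ! i). P (subtree_at v (ts ! i))}"
  let ?U = "\<Union>i < length ts. (#) i ` ?V i"
  have "card ?U = (\<Sum>i < length ts. card ((#) i ` ?V i))"
    by (rule card_UN_disjoint) (auto simp: finite_vertices)
  also have "\<dots> = (\<Sum>i < length ts. occurrences P (ts ! i))"
    by (simp add: card_image occurrences_def)
  also have "\<dots> = (\<Sum>t\<leftarrow>ts. occurrences P t)"
    by (simp add: sum_list_sum_nth atLeast0LessThan)
  finally have U: "card ?U = (\<Sum>t\<leftarrow>ts. occurrences P t)" .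
  have "{v \<in> vertices (Node ts). P (subtree_at v (Node ts))}
      = (if P (Node ts) then {[]} else {}) \<union> ?U"
    by (auto simp: vertices_Node)
  moreover have "[] \<notin> ?U" "finite ?U" by (auto simp: finite_vertices)
  ultimately show ?thesis by (simp add: occurrences_def[of P "Node ts"] U)
qed

definition num_leaves :: "plane_tree \<Rightarrow> nat" where
  "num_leaves t = card (leaves t)"

lemma num_leaves_Node: "num_leaves (Node ts) = (if ts = [] then 1 else (\<Sum>t\<leftarrow>ts. num_leaves t))"
proof -
  have "num_leaves t = occurrences (\<lambda>t. children t = []) t" for t
    by (simp add: num_leaves_def leaves_def occurrences_def num_children_def)
  then show ?thesis by (simp add: occurrences_Node)
qed

lemma num_leaves_neq_0: "num_leaves t \<noteq> 0"
proof (induction t)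
  case (Node ts)
  then show ?case by (cases ts) (auto simp: num_leaves_Node)
qed

text \<open>Zero or at least two children means a number of children other than 1, and this
  condition separates into the root and each child.\<close>

lemma schroeder_tree_Node:
  "schroeder_tree (Node ts) \<longleftrightarrow> length ts \<noteq> 1 \<and> (\<forall>t \<in> set ts. schroeder_tree t)"
proof -
  have two_le: "n \<ge> 2 \<longleftrightarrow> n \<noteq> 0 \<and> n \<noteq> 1" for n :: nat by auto
  have "schroeder_tree t \<longleftrightarrow> (\<forall>v \<in> vertices t. length (children (subtree_at v t)) \<noteq> 1)" for t
    unfolding schroeder_tree_def leaves_def num_children_def
    using two_le by (auto simp del: length_0_conv)
  then show ?thesis
    by (auto simp: vertices_Node all_set_conv_all_nth)
qed

section \<open>Trees and lists of trees\<close>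

abbreviation trees :: "plane_tree set" where
  "trees \<equiv> {t. schroeder_tree t}"

definition forest_leaves :: "plane_tree list \<Rightarrow> nat" where
  "forest_leaves ts = (\<Sum>t\<leftarrow>ts. num_leaves t)"

section \<open>Finiteness of the sets of trees and of lists with a given number of leaves\<close>

lemma length_le_forest_leaves: "length ts \<le> forest_leaves ts"
proof (induction ts)
  case (Cons t ts)
  then show ?case using num_leaves_neq_0[of t] by (simp add: forest_leaves_def)
qed (simp add: forest_leaves_def)

text \<open>Another entry of the list contributes at least one leaf. Strictness makes induction on
  the number of leaves possible.\<close>

lemma num_leaves_less_forest_leaves:
  assumes "t \<in> set ts" "length ts \<ge> 2"
  shows "num_leaves t < forest_leaves ts"
proof -
  obtain us ws where ts: "ts = us @ t # ws" using assms(1) by (meson split_list)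
  then have "us \<noteq> [] \<or> ws \<noteq> []" using assms(2) by auto
  then have "forest_leaves us + forest_leaves ws > 0"
    using length_le_forest_leaves[of us] length_le_forest_leaves[of ws]
    by (metis add_gr_0 length_greater_0_conv order_less_le_trans)
  then show ?thesis by (simp add: ts forest_leaves_def)
qed

lemma finite_levels_trees: "finite_levels trees num_leaves"
  unfolding finite_levels_def
proof
  fix n show "finite {t \<in> trees. num_leaves t = n}"
  proof (induction n rule: less_induct)
    case (less n)
    let ?A = "\<Union>m < n. {t \<in> trees. num_leaves t = m}"
    \<comment> \<open>The children of a non-leaf root have fewer than \<open>n\<close> leaves each
      and number at most \<open>n\<close>, so they form one of finitely many lists over a finite
      set.\<close>
    have "t \<in> insert (Node []) (Node ` {ts. set ts \<subseteq> ?A \<and> length ts \<le> n})"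
      if t: "schroeder_tree t" "num_leaves t = n" for t
    proof (cases t)
      case (Node ts)
      show ?thesis
      proof (cases "ts = []")
        case False
        then have "length ts \<noteq> 0" "length ts \<noteq> 1" and n: "forest_leaves ts = n"
          using t Node by (auto simp: schroeder_tree_Node num_leaves_Node forest_leaves_def)
        then have "length ts \<ge> 2" by linarith
        then have "num_leaves u < n" if "u \<in> set ts" for u
          using num_leaves_less_forest_leaves that n by blast
        then have "set ts \<subseteq> ?A"
          using t Node by (auto simp: schroeder_tree_Node)
        moreover have "length ts \<le> n"
          using length_le_forest_leaves[of ts] n by simp
        ultimately show ?thesis
          unfolding Node by blast
      qed (simp add: Node)
    qed
    then have "{t \<in> trees. num_leaves t = n}
        \<subseteq> insert (Node []) (Node ` {ts. set ts \<subseteq> ?A \<and> length ts \<le> n})" by blast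
    moreover have "finite ?A" using less by blast
    then have "finite (insert (Node []) (Node ` {ts. set ts \<subseteq> ?A \<and> length ts \<le> n}))"
      by (simp only: finite_insert finite_imageI finite_lists_length_le)
    ultimately show ?case by (rule finite_subset)
  qed
qed

lemma finite_levels_forests: "finite_levels (lists trees) forest_leaves"
  unfolding finite_levels_def
proof
  fix n
  \<comment> \<open>The bound includes \<open>n\<close>, since in a list of length 1 the single
    entry carries all leaves.\<close>
  let ?A = "\<Union>m \<le> n. {t \<in> trees. num_leaves t = m}"
  have "num_leaves t \<le> forest_leaves ts" if "t \<in> set ts" for t ts
    using that by (simp add: forest_leaves_def member_le_sum_list)
  then have "{ts \<in> lists trees. forest_leaves ts = n} \<subseteq> {ts. set ts \<subseteq> ?A \<and> length ts \<le> n}"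
    using length_le_forest_leaves by fastforce
  moreover have "finite ?A" using finite_levels_trees by (auto simp: finite_levels_def)
  ultimately show "finite {ts \<in> lists trees. forest_leaves ts = n}"
    by (rule finite_subset[OF _ finite_lists_length_le])
qed

lemma gf_forests_Cons:
  "gf (lists trees) forest_leaves w = fps_const (w []) +
    gf (trees \<times> lists trees) (\<lambda>(t, ts). num_leaves t + forest_leaves ts) (\<lambda>(t, ts). w (t # ts))"
proof -
  let ?h = "\<lambda>(t, ts). t # ts"
  have eq: "lists trees = {[]} \<union> ?h ` (trees \<times> lists trees)"
  proof (rule set_eqI)
    fix ts show "ts \<in> lists trees \<longleftrightarrow> ts \<in> {[]} \<union> ?h ` (trees \<times> lists trees)"
      by (cases ts) auto
  qed
  have "gf (lists trees) forest_leaves w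
      = gf {[]} forest_leaves w + gf (?h ` (trees \<times> lists trees)) forest_leaves w"
    using gf_union[of "{[]}" "?h ` (trees \<times> lists trees)" forest_leaves w] finite_levels_forests
    unfolding eq[symmetric] by (simp add: image_iff split_beta)
  moreover have "gf (?h ` (trees \<times> lists trees)) forest_leaves w
      = gf (trees \<times> lists trees) (\<lambda>p. forest_leaves (?h p)) (\<lambda>p. w (?h p))"
    by (rule gf_image) (auto simp: inj_on_def)
  moreover have "\<dots> = gf (trees \<times> lists trees) (\<lambda>(t, ts). num_leaves t + forest_leaves ts)
      (\<lambda>(t, ts). w (t # ts))"
    by (rule gf_cong) (auto simp: forest_leaves_def)
  ultimately show ?thesis by (simp add: gf_singleton forest_leaves_def)
qed

text \<open>
  A list of trees is the list of children of a Schroeder tree unless its length is 1; the empty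
  list has no leaves, whereas the one-vertex tree has one.
\<close>

lemma gf_forests_split:
  "gf (lists trees) forest_leaves w + fps_const (w []) * fps_X =
    gf trees num_leaves (\<lambda>t. w (children t)) + gf trees num_leaves (\<lambda>t. w [t]) + fps_const (w [])"
proof -
  \<comment> \<open>\<open>L\<close> is the common part of both sides: lists are empty, singletons
    or in \<open>L\<close>, while trees are the one-vertex tree or \<open>Node\<close> applied to an
    element of \<open>L\<close>.\<close>
  define L where "L = {ts \<in> lists trees. length ts \<ge> 2}"
  have len: "ts = [] \<or> (\<exists>t. ts = [t]) \<or> length ts \<ge> 2" for ts :: "plane_tree list"
    by (cases ts; cases "tl ts") auto
  have forests: "lists trees = {[]} \<union> ((\<lambda>t. [t]) ` trees \<union> L)"
  proof (rule set_eqI)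
    fix ts show "ts \<in> lists trees \<longleftrightarrow> ts \<in> {[]} \<union> ((\<lambda>t. [t]) ` trees \<union> L)"
      using len[of ts] by (auto simp: L_def)
  qed
  have nodes: "trees = {Node []} \<union> Node ` L"
  proof (rule set_eqI)
    fix t show "t \<in> trees \<longleftrightarrow> t \<in> {Node []} \<union> Node ` L"
      using len[of "children t"] by (cases t) (auto simp: schroeder_tree_Node L_def)
  qed
  have "gf (lists trees) forest_leaves w = fps_const (w []) +
      (gf ((\<lambda>t. [t]) ` trees) forest_leaves w + gf L forest_leaves w)"
  proof -
    have "finite_levels ((\<lambda>t. [t]) ` trees \<union> L) forest_leaves"
      using finite_levels_forests finite_levels_subset forests by blast
    then have "gf ((\<lambda>t. [t]) ` trees \<union> L) forest_leaves w
        = gf ((\<lambda>t. [t]) ` trees) forest_leaves w + gf L forest_leaves w"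
      by (rule gf_union) (auto simp: L_def)
    moreover have "gf (lists trees) forest_leaves w
        = gf {[]} forest_leaves w + gf ((\<lambda>t. [t]) ` trees \<union> L) forest_leaves w"
      using gf_union[of "{[]}" "(\<lambda>t. [t]) ` trees \<union> L" forest_leaves w] finite_levels_forests
      unfolding forests[symmetric] by (auto simp: L_def)
    ultimately show ?thesis by (simp add: gf_singleton forest_leaves_def)
  qed
  moreover have "gf ((\<lambda>t. [t]) ` trees) forest_leaves w = gf trees num_leaves (\<lambda>t. w [t])"
    by (subst gf_image) (auto simp: inj_on_def forest_leaves_def)
  moreover have "gf trees num_leaves (\<lambda>t. w (children t))
      = fps_const (w []) * fps_X + gf L forest_leaves w"
  proof -
    have "gf trees num_leaves (\<lambda>t. w (children t))
        = gf {Node []} num_leaves (\<lambda>t. w (children t)) + gf (Node ` L) num_leaves (\<lambda>t. w (children t))"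
      using gf_union[of "{Node []}" "Node ` L" num_leaves "\<lambda>t. w (children t)"]
        finite_levels_trees
      unfolding nodes[symmetric] by (simp add: image_iff L_def)
    moreover have "gf (Node ` L) num_leaves (\<lambda>t. w (children t))
        = gf L (\<lambda>ts. num_leaves (Node ts)) (\<lambda>ts. w (children (Node ts)))"
      by (rule gf_image) (auto simp: inj_on_def)
    moreover have "\<dots> = gf L forest_leaves w"
      by (rule gf_cong) (auto simp: L_def num_leaves_Node forest_leaves_def)
    ultimately show ?thesis by (simp add: gf_singleton num_leaves_Node)
  qed
  ultimately show ?thesis by simp
qed

section \<open>The functional equations\<close>

definition tree_gf :: "real fps" where
  "tree_gf = gf trees num_leaves (\<lambda>_. 1)"

definition forest_gf :: "real fps" where
  "forest_gf = gf (lists trees) forest_leaves (\<lambda>_. 1)"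

lemma forest_gf_Cons: "forest_gf = 1 + tree_gf * forest_gf"
  using gf_forests_Cons[of "\<lambda>_. 1"] gf_times[OF finite_levels_trees finite_levels_forests, of "\<lambda>_. 1" "\<lambda>_. 1"]
  by (simp add: forest_gf_def tree_gf_def)

lemma forest_gf_eq: "forest_gf = 1 + 2 * tree_gf - fps_X"
  using gf_forests_split[of "\<lambda>_. 1"] by (simp add: forest_gf_def tree_gf_def algebra_simps)

lemma tree_gf_nth_0: "fps_nth tree_gf 0 = 0"
  by (simp add: tree_gf_def gf_def num_leaves_neq_0)

lemma sqrt_series_eq: "sqrt_series = 1 + fps_X - 4 * tree_gf"
proof -
  let ?u = "1 + fps_X - 4 * tree_gf"
  have "1 + 2 * tree_gf - fps_X = 1 + tree_gf * (1 + 2 * tree_gf - fps_X)"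
    using forest_gf_Cons unfolding forest_gf_eq .
  \<comment> \<open>With S for \<open>tree_gf\<close>, the identity above reads 2 S^2 - (1 + x) S +
    x = 0; completing the square gives (1 + x)^2 - 8 x on the right.\<close>
  then have "?u ^ 2 = 1 - 6 * fps_X + fps_X ^ 2" by algebra
  then have "sqrt_series ^ 2 = ?u ^ 2" by (simp add: sqrt_series_squared)
  then have "sqrt_series = ?u \<or> sqrt_series = - ?u" by (simp only: power2_eq_iff)
  \<comment> \<open>The constant terms 1 and -1 decide the sign.\<close>
  moreover have "fps_nth sqrt_series 0 \<noteq> fps_nth (- ?u) 0"
    by (simp add: sqrt_series_nth_0 tree_gf_nth_0)
  ultimately show ?thesis by metis
qed

text \<open>The argument rests on the additivity of \<open>occurrences\<close> over root and
  children, hence works for any \<open>P\<close>. Denominators are cleared to keep it a ring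
  identity.\<close>

lemma marked_trees:
  defines "T \<equiv> \<lambda>P. gf trees num_leaves (\<lambda>t. real (occurrences P t))"
    and "R \<equiv> \<lambda>P. gf trees num_leaves (\<lambda>t. of_bool (P t))"
  shows "4 * sqrt_series * T P = R P * (3 - fps_X + sqrt_series)"
proof -
  \<comment> \<open>Here \<open>w [] = 0\<close>, so both correction terms of
    \<open>gf_forests_split\<close> vanish, and \<open>w [t]\<close> gives a second copy of
    \<open>T P\<close>.\<close>
  define w where "w = (\<lambda>ts. \<Sum>t\<leftarrow>ts. real (occurrences P t))"
  define M where "M = gf (lists trees) forest_leaves w"
  have "real (occurrences P t) = of_bool (P t) + w (children t)" for t
    by (cases t) (simp add: occurrences_Node w_def sum_list_sum_nth)
  then have "T P = R P + gf trees num_leaves (\<lambda>t. w (children t))"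
    unfolding T_def R_def by (simp add: gf_add)
  then have T: "2 * T P = R P + M"
    using gf_forests_split[of w] by (simp add: M_def T_def w_def algebra_simps)
  \<comment> \<open>The marked vertex lies in the head or in the tail of the list; the factors 1
    give each summand the shape required by \<open>gf_times\<close>.\<close>
  have "M = gf (trees \<times> lists trees) (\<lambda>(t, ts). num_leaves t + forest_leaves ts)
      (\<lambda>p. (case p of (t, ts) \<Rightarrow> real (occurrences P t) * 1) + (case p of (t, ts) \<Rightarrow> 1 * w ts))"
    unfolding M_def by (subst gf_forests_Cons) (auto simp: w_def intro!: gf_cong)
  also have "\<dots> = T P * forest_gf + tree_gf * M"
    unfolding gf_add
    by (simp only: gf_times[OF finite_levels_trees finite_levels_forests] T_def forest_gf_def
        tree_gf_def M_def)
  finally have M: "M - tree_gf * M = T P * forest_gf" by (simp add: algebra_simps)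
  have R: "R P = 2 * T P - M" using T by (simp add: algebra_simps)
  \<comment> \<open>Multiplying by 1 - S turns the unknown \<open>M\<close> into
    \<open>T P * forest_gf\<close>. The remaining factor of \<open>T P\<close> is 2 (1 - S) - (1 + 2
    S - x) = 1 + x - 4 S, the square root.\<close>
  have "R P * (1 - tree_gf) = 2 * T P * (1 - tree_gf) - (M - tree_gf * M)"
    unfolding R by (simp add: algebra_simps)
  also have "\<dots> = sqrt_series * T P"
    unfolding M sqrt_series_eq forest_gf_eq by (simp add: algebra_simps)
  finally have "4 * sqrt_series * T P = 4 * (R P * (1 - tree_gf))"
    by (simp only: mult.assoc)
  also have "\<dots> = R P * (4 * (1 - tree_gf))"
    by (rule mult.left_commute)
  also have "4 * (1 - tree_gf) = 3 - fps_X + sqrt_series"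
    unfolding sqrt_series_eq by (simp add: algebra_simps)
  finally show ?thesis .
qed

section \<open>Passage to the series \<open>T_series\<close> and \<open>R_series\<close>\<close>

lemma schroeder_trees_eq: "schroeder_trees n = {t \<in> trees. num_leaves t = n}"
  by (simp add: schroeder_trees_def num_leaves_def)

text \<open>Every tree has a leaf, so the coefficient 0 prescribed at \<open>n = 0\<close> in both
  series agrees with the count.\<close>

lemma schroeder_trees_0: "schroeder_trees 0 = {}"
  by (simp add: schroeder_trees_eq num_leaves_neq_0)

lemma T_series_gf:
  "T_series k = gf trees num_leaves (\<lambda>t. real (occurrences (\<lambda>t. num_vertices t = k) t))"
proof (rule fps_ext)
  fix n show "fps_nth (T_series k) n
      = fps_nth (gf trees num_leaves (\<lambda>t. real (occurrences (\<lambda>t. num_vertices t = k) t))) n"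
    unfolding T_series_def gf_def t_count_def occurrences_def schroeder_trees_eq[symmetric]
    by (cases "n = 0") (simp_all add: schroeder_trees_0)
qed

lemma R_series_gf: "R_series k = gf trees num_leaves (\<lambda>t. of_bool (num_vertices t = k))"
proof (rule fps_ext)
  fix n
  have "finite (schroeder_trees n)"
    using finite_levels_trees unfolding schroeder_trees_eq finite_levels_def by blast
  then have "(\<Sum>t \<in> schroeder_trees n. of_bool (num_vertices t = k)) = real (r_count n k)"
    by (simp add: r_count_def Int_def)
  then show "fps_nth (R_series k) n
      = fps_nth (gf trees num_leaves (\<lambda>t. of_bool (num_vertices t = k))) n"
    unfolding R_series_def gf_def schroeder_trees_eq[symmetric]
    by (cases "n = 0") (simp_all add: schroeder_trees_0)
qed

theorem lemma3p1:
  fixes k :: nat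
  assumes "k \<ge> 1"
  shows "T_series k = R_series k * ((3 - fps_X + sqrt_series) / (4 * sqrt_series))"
proof -
  have eq: "4 * sqrt_series * T_series k = R_series k * (3 - fps_X + sqrt_series)"
    unfolding T_series_gf R_series_gf by (rule marked_trees)
  \<comment> \<open>The constant term is 4, so the denominator is invertible and the quotient is
    multiplication by its inverse.\<close>
  have unit: "fps_nth (4 * sqrt_series) 0 \<noteq> 0"
    by (simp add: sqrt_series_nth_0)
  have "R_series k * ((3 - fps_X + sqrt_series) / (4 * sqrt_series))
      = 4 * sqrt_series * T_series k * inverse (4 * sqrt_series)"
    unfolding fps_divide_unit[OF unit] eq by (rule mult.assoc[symmetric])
  also have "\<dots> = T_series k * (inverse (4 * sqrt_series) * (4 * sqrt_series))"
    by (simp only: mult.assoc mult.commute mult.left_commute)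
  also have "\<dots> = T_series k"
    unfolding inverse_mult_eq_1[OF unit] by (rule mult_1_right)
  finally show ?thesis by (rule sym)
qed

end
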